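(* Let $\mathfrak{H}=\mathfrak{H}_0\oplus\mathfrak{H}_1$ be an orthogonal decomposition of a finite dimensional complex Hilbert space, let $A_0\in\mathcal{L}(\mathfrak{H}_0)$ and $A_1\in\mathcal{L}(\mathfrak{H}_1)$ be self-adjoint, let $V\in\mathcal{L}(\mathfrak{H}_1,\mathfrak{H}_0)$, and let $$\mathbf{B}=\begin{pmatrix} A_0 & V \\ V^\ast & A_1 \end{pmatrix}\in\mathcal{L}(\mathfrak{H}_0\oplus\mathfrak{H}_1).$$ Assume that the spectra of $\mathbf{B}$ and $A_0$ are disjoint. Then there exists at least one bounded solution $X\in\mathcal{L}(\mathfrak{H}_0,\mathfrak{H}_1)$ to the Riccati equation $$A_1X-XA_0-XVX+V^\ast=0 .$$
   Context: $\mathcal{L}(\mathfrak{H},\mathfrak{K})$ denotes the bounded linear operators from $\mathfrak{H}$ to $\mathfrak{K}$, and $\mathcal{L}(\mathfrak{H})=\mathcal{L}(\mathfrak{H},\mathfrak{H})$. No cyclicity assumption on $\operatorname{Ran}V$ is made. *)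

theory Defs
  imports "HOL-Analysis.Analysis"
begin

text \<open>
  Complex Hilbert spaces, on top of the real structure of the library: the real inner product
  is the real part of the complex one, so that \<open>norm x = sqrt (Re (cinner x x))\<close>.
  The form \<open>cinner\<close> is antilinear in the first and linear in the second argument.
\<close>

class complex_inner = real_inner +
  fixes scaleC :: "complex \<Rightarrow> 'a \<Rightarrow> 'a" (infixr "*\<^sub>C" 75)
    and cinner :: "'a \<Rightarrow> 'a \<Rightarrow> complex"
  assumes scaleR_scaleC: "r *\<^sub>R x = complex_of_real r *\<^sub>C x"
    and scaleC_add_right: "c *\<^sub>C (x + y) = c *\<^sub>C x + c *\<^sub>C y"
    and scaleC_add_left: "(c + d) *\<^sub>C x = c *\<^sub>C x + d *\<^sub>C x"
    and scaleC_scaleC: "c *\<^sub>C d *\<^sub>C x = (c * d) *\<^sub>C x"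
    and scaleC_one: "1 *\<^sub>C x = x"
    and cinner_commute: "cinner x y = cnj (cinner y x)"
    and cinner_add_right: "cinner x (y + z) = cinner x y + cinner x z"
    and cinner_scaleC_right: "cinner x (c *\<^sub>C y) = c * cinner x y"
    and Re_cinner: "Re (cinner x y) = inner x y"

class chilbert_space = complex_inner + complete_space

global_interpretation complex_vector:
  vector_space "scaleC :: complex \<Rightarrow> 'a \<Rightarrow> 'a::complex_inner"
  by unfold_locales
    (rule scaleC_add_right scaleC_add_left scaleC_scaleC scaleC_one)+

instantiation complex :: chilbert_space
begin

definition scaleC_complex :: "complex \<Rightarrow> complex \<Rightarrow> complex"
  where "scaleC_complex c x = c * x"

definition cinner_complex :: "complex \<Rightarrow> complex \<Rightarrow> complex"
  where "cinner_complex x y = cnj x * y"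

instance
  by standard
    (simp_all add: scaleC_complex_def cinner_complex_def inner_complex_def scaleR_conv_of_real
      algebra_simps)

end

text \<open>
  The type \<open>'a \<times> 'b\<close> is the Hilbert space direct sum: the two summands are orthogonal, and the
  library norm on pairs is the norm of this inner product.
\<close>

instantiation prod :: (complex_inner, complex_inner) complex_inner
begin

definition scaleC_prod :: "complex \<Rightarrow> 'a \<times> 'b \<Rightarrow> 'a \<times> 'b"
  where "scaleC_prod c x = (c *\<^sub>C fst x, c *\<^sub>C snd x)"

definition cinner_prod :: "'a \<times> 'b \<Rightarrow> 'a \<times> 'b \<Rightarrow> complex"
  where "cinner_prod x y = cinner (fst x) (fst y) + cinner (snd x) (snd y)"

instance
proof
  fix x y :: "'a \<times> 'b"
  show "cinner x y = cnj (cinner y x)"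
    unfolding cinner_prod_def complex_cnj_add
    using cinner_commute[of "fst x" "fst y"] cinner_commute[of "snd x" "snd y"] by simp
qed (simp_all add: scaleC_prod_def cinner_prod_def prod_eq_iff scaleR_scaleC scaleC_add_right
      scaleC_add_left scaleC_scaleC scaleC_one cinner_add_right cinner_scaleC_right
      Re_cinner inner_prod_def distrib_left)

end

instance prod :: (chilbert_space, chilbert_space) chilbert_space ..

definition bounded_clinear :: "('a::complex_inner \<Rightarrow> 'b::complex_inner) \<Rightarrow> bool"
  where "bounded_clinear T \<longleftrightarrow> bounded_linear T \<and> (\<forall>c x. T (c *\<^sub>C x) = c *\<^sub>C T x)"

text \<open>
  The adjoint is unique whenever it exists, and it exists for every \<open>bounded_clinear\<close> operator
  between Hilbert spaces; it is not specified otherwise.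
\<close>

definition cadjoint :: "('a::complex_inner \<Rightarrow> 'b::complex_inner) \<Rightarrow> 'b \<Rightarrow> 'a"
  where "cadjoint T = (THE S. \<forall>x y. cinner (T x) y = cinner x (S y))"

definition self_adjoint :: "('a::complex_inner \<Rightarrow> 'a) \<Rightarrow> bool"
  where "self_adjoint T \<longleftrightarrow> bounded_clinear T \<and> cadjoint T = T"

definition resolvent_set :: "('a::complex_inner \<Rightarrow> 'a) \<Rightarrow> complex set"
  where "resolvent_set T =
    {z. \<exists>R. bounded_clinear R \<and>
        (\<forall>x. R (T x - z *\<^sub>C x) = x) \<and> (\<forall>x. T (R x) - z *\<^sub>C R x = x)}"

definition spectrum :: "('a::complex_inner \<Rightarrow> 'a) \<Rightarrow> complex set"
  where "spectrum T = - resolvent_set T"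

definition block_operator ::
  "('a \<Rightarrow> 'a) \<Rightarrow> ('b \<Rightarrow> 'a) \<Rightarrow> ('a \<Rightarrow> 'b) \<Rightarrow> ('b \<Rightarrow> 'b) \<Rightarrow>
    'a::complex_inner \<times> 'b::complex_inner \<Rightarrow> 'a \<times> 'b"
  where "block_operator P Q R S = (\<lambda>(x, y). (P x + Q y, R x + S y))"

end

theory Submission
  imports Defs "HOL-Computational_Algebra.Fundamental_Theorem_Algebra"
begin

text \<open>
  The Riccati equation says that the graph of \<open>X\<close> is invariant under \<open>B\<close>. As \<open>B\<close> is symmetric on a
  finite dimensional space, its eigenvectors span \<open>H\<^sub>0 \<oplus> H\<^sub>1\<close>, so their first components span
  \<open>H\<^sub>0\<close>. Select eigenvectors \<open>(x\<^sub>i, y\<^sub>i)\<close> for which the \<open>x\<^sub>i\<close> form a basis of \<open>H\<^sub>0\<close>; the linear map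
  with \<open>X x\<^sub>i = y\<^sub>i\<close> has the span of these eigenvectors as its graph.
\<close>

section \<open>Complex linear maps and their relation to bounded ones\<close>

abbreviation clinear :: "('a::complex_inner \<Rightarrow> 'b::complex_inner) \<Rightarrow> bool"
  where "clinear \<equiv> Vector_Spaces.linear scaleC scaleC"

interpretation complex_pair: vector_space_pair
  "scaleC :: complex \<Rightarrow> 'a \<Rightarrow> 'a::complex_inner"
  "scaleC :: complex \<Rightarrow> 'b \<Rightarrow> 'b::complex_inner"
  by unfold_locales

lemma clinearI:
  assumes "\<And>x y. T (x + y) = T x + T y" "\<And>c x. T (c *\<^sub>C x) = c *\<^sub>C T x"
  shows "clinear T"
  by unfold_locales (use assms in auto)

lemmas clinear_add = complex_pair.linear_add
  and clinear_scale = complex_pair.linear_scale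
  and clinear_diff = complex_pair.linear_diff
  and clinear_0 = complex_pair.linear_0

lemma bounded_clinear_imp_clinear: "bounded_clinear T \<Longrightarrow> clinear T"
  by (auto simp: bounded_clinear_def bounded_linear.axioms(1) linear_add intro!: clinearI)

lemma bounded_clinearI:
  assumes "clinear T" "\<And>x. norm (T x) \<le> norm x * K"
  shows "bounded_clinear T"
  unfolding bounded_clinear_def
proof (intro conjI bounded_linear_intro)
  show "T (r *\<^sub>R x) = r *\<^sub>R T x" for r x
    by (simp add: scaleR_scaleC clinear_scale[OF assms(1)])
qed (use assms in \<open>auto simp: clinear_add clinear_scale\<close>)

subsection \<open>The complex inner product\<close>

lemma cinner_add_left: "cinner (x + y) z = cinner x z + cinner y z"
  by (metis cinner_add_right cinner_commute complex_cnj_add)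

lemma cinner_scaleC_left: "cinner (c *\<^sub>C x) y = cnj c * cinner x y"
  by (metis cinner_scaleC_right cinner_commute complex_cnj_mult)

lemma cinner_diff_right: "cinner x (y - z) = cinner x y - cinner x z"
  by (metis add_diff_cancel_right' cinner_add_right diff_add_cancel)

lemma cinner_diff_left: "cinner (x - y) z = cinner x z - cinner y z"
  by (metis add_diff_cancel_right' cinner_add_left diff_add_cancel)

lemma cinner_zero_left [simp]: "cinner 0 x = 0"
  by (metis cinner_diff_left diff_self)

lemma cinner_zero_right [simp]: "cinner x 0 = 0"
  by (metis cinner_diff_right diff_self)

lemma cinner_self_eq_0 [simp]: "cinner x x = 0 \<longleftrightarrow> x = 0"
  by (metis Re_cinner cinner_zero_left inner_eq_zero_iff zero_complex.sel(1))

lemma cinner_self_cnj: "cnj (cinner x x) = cinner x x"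
  by (metis cinner_commute)

lemma cinner_ext: "(\<And>x. cinner x y = cinner x z) \<Longrightarrow> y = z"
  by (metis cinner_diff_right cinner_self_eq_0 eq_iff_diff_eq_0)

lemma norm_scaleC: "norm (c *\<^sub>C (x::'a::complex_inner)) = cmod c * norm x"
proof -
  have "complex_of_real ((norm (c *\<^sub>C x))\<^sup>2) = complex_of_real ((cmod c * norm x)\<^sup>2)"
  proof (rule complex_eqI)
    have "cinner (c *\<^sub>C x) (c *\<^sub>C x) = of_real ((cmod c)\<^sup>2) * cinner x x"
      unfolding cinner_scaleC_left cinner_scaleC_right complex_norm_square by simp
    then show "Re (complex_of_real ((norm (c *\<^sub>C x))\<^sup>2)) = Re (complex_of_real ((cmod c * norm x)\<^sup>2))"
      by (simp add: power2_norm_eq_inner power_mult_distrib flip: Re_cinner)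
  qed simp
  then show ?thesis
    by (simp only: of_real_eq_iff) (simp add: power2_eq_iff_nonneg)
qed

lemma norm_cinner_le: "cmod (cinner x y) \<le> norm x * norm y"
proof -
  \<comment> \<open>Multiplying \<open>y\<close> by this phase turns the inner product into its
    modulus, which reduces the claim to the real Cauchy-Schwarz inequality. As
    \<open>sgn 0 = 0\<close>, the modulus of \<open>u\<close> is at most 1 in every case.\<close>
  define u where "u = cnj (sgn (cinner x y))"
  have "u * cinner x y = of_real (cmod (cinner x y))"
    by (cases "cinner x y = 0")
      (auto simp: u_def sgn_eq complex_norm_square power2_eq_square mult.commute
        nonzero_divide_eq_eq simp flip: complex_norm_square)
  then have "cmod (cinner x y) = Re (cinner x (u *\<^sub>C y))"
    by (simp add: cinner_scaleC_right)
  also have "\<dots> \<le> norm x * norm (u *\<^sub>C y)"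
    by (simp add: Re_cinner norm_cauchy_schwarz)
  also have "\<dots> \<le> norm x * norm y"
    by (auto simp: norm_scaleC u_def norm_sgn intro!: mult_left_mono)
  finally show ?thesis .
qed

subsection \<open>Operators on finite dimensional spaces\<close>

text \<open>
  Gram--Schmidt: adding \<open>s\<close> to the spanning set changes the orthogonal projection \<open>P\<close> by a rank one
  term in the direction \<open>s - P s\<close>. For a set spanning the whole space, \<open>P\<close> is the identity, so \<open>X\<close>
  itself is bounded and has an adjoint.
\<close>

lemma clinear_comp_projection:
  fixes X :: "'a::complex_inner \<Rightarrow> 'b::complex_inner"
  assumes "finite S" and X: "clinear X"
  shows "\<exists>P. clinear P \<and> (\<forall>x y. cinner (P x) y = cinner x (P y)) \<and>
    (\<forall>x. P x \<in> complex_vector.span S) \<and> (\<forall>x\<in>complex_vector.span S. P x = x) \<and>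
    (\<exists>K. \<forall>x. norm (X (P x)) \<le> norm x * K) \<and>
    (\<exists>Y. \<forall>x y. cinner (X (P x)) y = cinner x (Y y))"
  using \<open>finite S\<close>
proof (induction S)
  case empty
  have "clinear (\<lambda>x. 0 :: 'a)"
    by (rule clinearI) auto
  moreover have "\<exists>K. \<forall>x::'a. norm (X 0) \<le> norm x * K"
    by (rule exI[of _ 0]) (simp add: clinear_0[OF X])
  moreover have "\<exists>Y. \<forall>(x::'a) y. cinner (X 0) y = cinner x (Y y)"
    by (rule exI[of _ "\<lambda>_. 0"]) (simp add: clinear_0[OF X])
  ultimately show ?case
    by (intro exI[of _ "\<lambda>x. 0"]) simp
next
  case (insert s S)
  then obtain P K Y where P: "clinear P" and sym: "\<And>x y. cinner (P x) y = cinner x (P y)"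
    and ran: "\<And>x. P x \<in> complex_vector.span S" and fix_P: "\<And>x. x \<in> complex_vector.span S \<Longrightarrow> P x = x"
    and K: "\<And>x. norm (X (P x)) \<le> norm x * K" and Y: "\<And>x y. cinner (X (P x)) y = cinner x (Y y)"
    by metis
  define r where "r = s - P s"
  show ?case
  proof (cases "r = 0")
    case True
    then have "complex_vector.span (insert s S) = complex_vector.span S"
      using ran[of s] by (simp add: r_def complex_vector.span_redundant)
    with P sym ran fix_P K Y show ?thesis
      by (intro exI[of _ P]) auto
  next
    case False
    define k where "k = inverse (cinner r r)"
    have k_cnj: "cnj k = k"
      by (simp add: k_def cinner_self_cnj)
    \<comment> \<open>\<open>r\<close> will be orthogonal to the span of \<open>S\<close>, and
      \<open>k\<close> normalizes it, so the added term is the orthogonal projection onto the line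
      through \<open>r\<close>.\<close>
    define Q where "Q x = P x + (k * cinner r x) *\<^sub>C r" for x
    have orth: "cinner r x = 0" if "x \<in> complex_vector.span S" for x
      using sym[of s x] fix_P[OF that] by (simp add: r_def cinner_diff_left)
    have "cinner r s = cinner r r"
      using orth[OF ran, of s] by (simp add: r_def cinner_diff_right)
    then have Q_s: "Q s = s"
      using False by (simp add: Q_def k_def r_def complex_vector.scale_one)
    have Q: "clinear Q"
      by (rule clinearI)
        (simp_all add: Q_def clinear_add[OF P] clinear_scale[OF P] cinner_add_right
          cinner_scaleC_right algebra_simps)
    \<comment> \<open>The rank one correction is bounded by Cauchy-Schwarz, and its adjoint sends
      \<open>y\<close> to \<open>(k * cinner (X r) y) *\<^sub>C r\<close> because \<open>k\<close>
      is real. Both are added to the bound and the adjoint known for \<open>P\<close>.\<close>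
    have XQ: "X (Q x) = X (P x) + (k * cinner r x) *\<^sub>C X r" for x
      by (simp add: Q_def clinear_add[OF X] clinear_scale[OF X])
    have "cinner (Q x) y = cinner x (Q y)" for x y
      using cinner_commute[of x r]
      by (simp add: Q_def cinner_add_left cinner_add_right cinner_scaleC_left cinner_scaleC_right
          sym k_cnj algebra_simps)
    moreover have "Q x \<in> complex_vector.span (insert s S)" for x
    proof -
      have "P y \<in> complex_vector.span (insert s S)" for y
        using ran complex_vector.span_mono[of S "insert s S"] by blast
      then show ?thesis
        unfolding Q_def r_def
        by (intro complex_vector.span_add complex_vector.span_scale complex_vector.span_diff)
          (simp_all add: complex_vector.span_base)
    qed
    moreover have "Q x = x" if x: "x \<in> complex_vector.span (insert s S)" for x
    proof -
      obtain c where c: "x - c *\<^sub>C s \<in> complex_vector.span S"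
        using x complex_vector.span_breakdown_eq by blast
      have "Q (x - c *\<^sub>C s) = x - c *\<^sub>C s"
        using fix_P[OF c] orth[OF c] by (simp add: Q_def)
      then show ?thesis
        by (simp add: clinear_diff[OF Q] clinear_scale[OF Q] Q_s)
    qed
    moreover have "norm (X (Q x)) \<le> norm x * (K + cmod k * norm r * norm (X r))" for x
    proof -
      have "norm (X (Q x)) \<le> norm (X (P x)) + cmod k * cmod (cinner r x) * norm (X r)"
        unfolding XQ by (metis norm_triangle_ineq norm_scaleC norm_mult)
      also have "\<dots> \<le> norm x * K + cmod k * (norm r * norm x) * norm (X r)"
        by (intro add_mono mult_right_mono mult_left_mono K norm_cinner_le) auto
      finally show ?thesis
        by (simp add: algebra_simps)
    qed
    moreover have "cinner (X (Q x)) y = cinner x (Y y + (k * cinner (X r) y) *\<^sub>C r)" for x y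
      unfolding XQ using cinner_commute[of x r]
      by (simp add: cinner_add_left cinner_add_right cinner_scaleC_left cinner_scaleC_right
          Y k_cnj algebra_simps)
    ultimately show ?thesis
      using Q
      by (intro exI[of _ Q] conjI exI[of _ "K + cmod k * norm r * norm (X r)"]
          exI[of _ "\<lambda>y. Y y + (k * cinner (X r) y) *\<^sub>C r"]) simp_all
  qed
qed

lemma finite_dim_clinear:
  fixes X :: "'a::complex_inner \<Rightarrow> 'b::complex_inner"
  assumes "finite S" "complex_vector.span S = (UNIV :: 'a set)" "clinear X"
  shows "bounded_clinear X" "cinner (X x) y = cinner x (cadjoint X y)"
proof -
  obtain K Y where K: "\<And>x. norm (X x) \<le> norm x * K" and Y: "\<And>x y. cinner (X x) y = cinner x (Y y)"
    using clinear_comp_projection[OF assms(1,3)] assms(2) by (metis UNIV_I)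
  show "bounded_clinear X"
    using bounded_clinearI[OF assms(3) K] .
  \<comment> \<open>Nondegeneracy of the inner product makes the adjoint unique, so the description
    in \<open>cadjoint\<close> denotes \<open>Y\<close>.\<close>
  have "cadjoint X = Y"
    unfolding cadjoint_def
  proof (rule the_equality)
    show "\<forall>x y. cinner (X x) y = cinner x (Y y)"
      using Y by blast
    show "Z = Y" if "\<forall>x y. cinner (X x) y = cinner x (Z y)" for Z
      using that Y by (metis cinner_ext ext)
  qed
  then show "cinner (X x) y = cinner x (cadjoint X y)"
    using Y by simp
qed

text \<open>Moving \<open>S\<close> to the other side as \<open>T\<close> leaves an inner product
  that is linear in its second argument, and nondegeneracy does the rest. It serves for
  \<open>cadjoint V\<close> and, with \<open>S = T\<close>, for symmetric maps.\<close>

lemma clinear_if_adjoint: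
  assumes "\<And>x y. cinner (T x) y = cinner x (S y)"
  shows "clinear S"
proof (rule clinearI)
  show "S (x + y) = S x + S y" for x y
    by (rule cinner_ext) (simp add: cinner_add_right flip: assms)
  show "S (c *\<^sub>C x) = c *\<^sub>C S x" for c x
    by (rule cinner_ext) (simp add: cinner_scaleC_right flip: assms)
qed

subsection \<open>Eigenvectors of symmetric operators\<close>

text \<open>The zero vector is included; this leaves the span unchanged and saves a case
  distinction.\<close>

definition eigenvectors :: "('a::complex_inner \<Rightarrow> 'a) \<Rightarrow> 'a set"
  where "eigenvectors T = {x. \<exists>a. T x = a *\<^sub>C x}"

text \<open>This rules out Jordan chains of length two. If \<open>w\<close> were nonzero,
  \<open>a\<close> would be real, so moving \<open>T - a\<close> from \<open>x\<close> to
  \<open>w\<close> would give \<open>cinner w w = 0\<close>.\<close>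

lemma symmetric_kernel_square:
  assumes sym: "\<And>x y. cinner (T x) y = cinner x (T y)"
    and w: "T w = a *\<^sub>C w" "T x = a *\<^sub>C x + w"
  shows "w = 0"
proof (rule ccontr)
  assume "w \<noteq> 0"
  moreover have "cnj a * cinner w w = a * cinner w w"
    using sym[of w w] by (simp add: w cinner_scaleC_left cinner_scaleC_right)
  ultimately have "cnj a = a"
    by simp
  then have "cinner w w = 0"
    using sym[of w x]
    by (simp add: w cinner_scaleC_left cinner_scaleC_right cinner_add_right)
  with \<open>w \<noteq> 0\<close> show False
    by simp
qed

text \<open>The vector \<open>p(T) v\<close>, evaluated by the Horner scheme.\<close>

definition poly_apply :: "('a::complex_inner \<Rightarrow> 'a) \<Rightarrow> complex poly \<Rightarrow> 'a \<Rightarrow> 'a"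
  where "poly_apply T p v = fold_coeffs (\<lambda>c w. c *\<^sub>C v + T w) p 0"

context
  fixes T :: "'a::complex_inner \<Rightarrow> 'a"
  assumes T: "clinear T"
begin

lemma poly_apply_0 [simp]: "poly_apply T 0 v = 0"
  by (simp add: poly_apply_def)

lemma poly_apply_pCons [simp]: "poly_apply T (pCons c p) v = c *\<^sub>C v + T (poly_apply T p v)"
  \<comment> \<open>\<open>pCons 0 0\<close> has an empty coefficient list, so the fold takes no
    step there and the equation rests on \<open>T 0 = 0\<close>.\<close>
  by (cases "c = 0 \<and> p = 0") (auto simp: poly_apply_def clinear_0[OF T])

lemma poly_apply_add: "poly_apply T (p + q) v = poly_apply T p v + poly_apply T q v"
  by (induction p q rule: poly_induct2) (simp_all add: clinear_add[OF T] algebra_simps)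

lemma poly_apply_smult: "poly_apply T (smult c p) v = c *\<^sub>C poly_apply T p v"
  by (induction p) (simp_all add: clinear_add[OF T] clinear_scale[OF T] algebra_simps)

lemma poly_apply_monom: "poly_apply T (monom 1 n) v = (T ^^ n) v"
  by (induction n) (simp_all add: monom_0 monom_Suc clinear_0[OF T])

text \<open>\<open>p(T)\<close> commutes with \<open>T - a\<close>. Hence splitting a root off a
  polynomial that annihilates \<open>v\<close> leaves one that annihilates
  \<open>T v - a *\<^sub>C v\<close>.\<close>

lemma poly_apply_linear_factor:
  "poly_apply T ([:- a, 1:] * p) v = poly_apply T p (T v - a *\<^sub>C v)"
proof -
  have "poly_apply T p (T v - a *\<^sub>C v) = T (poly_apply T p v) - a *\<^sub>C poly_apply T p v"
  proof (induction p)
    case (pCons c p)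
    show ?case
      unfolding poly_apply_pCons pCons.IH
      by (simp add: clinear_add[OF T] clinear_scale[OF T] clinear_diff[OF T] algebra_simps)
  qed (simp add: clinear_0[OF T])
  moreover have "[:- a, 1:] * p = smult (- a) p + pCons 0 p"
    by simp
  ultimately show ?thesis
    by (simp only: poly_apply_add poly_apply_smult poly_apply_pCons) simp
qed

lemma annihilating_poly_exists:
  assumes "finite S" "complex_vector.span S = (UNIV :: 'a set)"
  obtains p where "p \<noteq> 0" "poly_apply T p v = 0"
proof -
  define U where "U n = (\<lambda>i. (T ^^ i) v) ` {..<n}" for n
  have U_Suc: "U (Suc n) = insert ((T ^^ n) v) (U n)" for n
    by (simp add: U_def lessThan_Suc)
  \<comment> \<open>Otherwise the first \<open>n\<close> iterates would be independent and distinct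
    for every \<open>n\<close>, against the bound \<open>card S\<close>.\<close>
  have "\<exists>n. (T ^^ n) v \<in> complex_vector.span (U n)"
  proof (rule ccontr)
    assume *: "\<nexists>n. (T ^^ n) v \<in> complex_vector.span (U n)"
    then have "(T ^^ n) v \<notin> U n" for n
      using complex_vector.span_base by blast
    moreover have "finite (U n)" "U 0 = {}" for n
      by (simp_all add: U_def)
    ultimately have "\<not> complex_vector.dependent (U n) \<and> card (U n) = n" for n
      using * by (induction n) (simp_all add: U_Suc complex_vector.independent_insert
          complex_vector.independent_empty)
    then show False
      using complex_vector.independent_span_bound[OF assms(1), of "U (Suc (card S))"] assms(2)
      by (metis Suc_n_not_le_n subset_UNIV)
  qed
  then obtain n where n: "(T ^^ n) v \<in> complex_vector.span (U n)"
    by blast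
  \<comment> \<open>Every vector in the span of the first \<open>n\<close> iterates is
    \<open>q(T) v\<close> with \<open>q\<close> of degree below \<open>n\<close>.\<close>
  have "\<exists>q. (\<forall>i\<ge>n. coeff q i = 0) \<and> poly_apply T q v = w"
    if "w \<in> complex_vector.span (U n)" for w
    using that
  proof (induction rule: complex_vector.span_induct_alt)
    case base
    show ?case
      by (rule exI[of _ 0]) simp
  next
    case (step c x y)
    then obtain i q where "i < n" "x = (T ^^ i) v" "\<forall>i\<ge>n. coeff q i = 0" "poly_apply T q v = y"
      by (auto simp: U_def)
    then show ?case
      by (intro exI[of _ "smult c (monom 1 i) + q"])
        (simp add: poly_apply_add poly_apply_smult poly_apply_monom)
  qed
  with n obtain q where q: "\<forall>i\<ge>n. coeff q i = 0" "poly_apply T q v = (T ^^ n) v"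
    by blast
  show thesis
  proof
    \<comment> \<open>\<open>q\<close> has no coefficient at \<open>n\<close>, so subtracting it
      cannot cancel the leading term.\<close>
    have "coeff (monom 1 n + smult (- 1) q) n = 1"
      using q by simp
    then show "monom 1 n + smult (- 1) q \<noteq> 0"
      by (metis coeff_0 zero_neq_one)
    show "poly_apply T (monom 1 n + smult (- 1) q) v = 0"
      using q by (simp only: poly_apply_add poly_apply_smult poly_apply_monom)
        (simp add: complex_vector.scale_one)
  qed
qed

text \<open>The equation \<open>(T - a) u = w\<close> is solved up to an error \<open>z\<close> in
  the kernel of \<open>T - a\<close>: eigenvectors in \<open>w\<close> for other eigenvalues are
  divided by the difference, those for \<open>a\<close> go into \<open>z\<close>.\<close>

lemma span_eigenvectors_decomp:
  assumes "w \<in> complex_vector.span (eigenvectors T)"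
  shows "\<exists>u\<in>complex_vector.span (eigenvectors T). \<exists>z. T z = a *\<^sub>C z \<and> T u = a *\<^sub>C u + w - z"
  using assms
proof (induction rule: complex_vector.span_induct_alt)
  case base
  show ?case
    by (intro bexI[of _ 0] exI[of _ 0]) (simp_all add: clinear_0[OF T] complex_vector.span_zero)
next
  case (step c x y)
  then obtain b u z where x: "T x = b *\<^sub>C x" and u: "u \<in> complex_vector.span (eigenvectors T)"
    and z: "T z = a *\<^sub>C z" "T u = a *\<^sub>C u + y - z"
    by (auto simp: eigenvectors_def)
  show ?case
  proof (cases "b = a")
    case True
    then show ?thesis
      using u z x by (intro bexI[of _ u] exI[of _ "z + c *\<^sub>C x"])
        (simp_all add: clinear_add[OF T] clinear_scale[OF T] algebra_simps)
  next
    case False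
    \<comment> \<open>Chosen so that \<open>T - a\<close> maps \<open>k *\<^sub>C x\<close> to
      \<open>c *\<^sub>C x\<close>.\<close>
    define k where "k = c / (b - a)"
    have "k * b = a * k + c"
      using False by (simp add: k_def divide_simps) (simp add: algebra_simps)
    then have "T (u + k *\<^sub>C x) = a *\<^sub>C (u + k *\<^sub>C x) + (c *\<^sub>C x + y) - z"
      by (simp add: clinear_add[OF T] clinear_scale[OF T] z x algebra_simps)
    moreover have "u + k *\<^sub>C x \<in> complex_vector.span (eigenvectors T)"
      using step(1) u by (intro complex_vector.span_add complex_vector.span_scale)
        (simp_all add: complex_vector.span_base)
    ultimately show ?thesis
      using z(1) by blast
  qed
qed

text \<open>Induction on the degree: for a root \<open>a\<close> of \<open>p\<close>, the vector
  \<open>(T - a) v\<close> is annihilated by a polynomial of smaller degree, so it lies in the span,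
  and it remains to lift this to \<open>v\<close>.\<close>

lemma span_eigenvectors_if_annihilated:
  assumes sym: "\<And>x y. cinner (T x) y = cinner x (T y)"
    and "p \<noteq> 0" "poly_apply T p v = 0"
  shows "v \<in> complex_vector.span (eigenvectors T)"
  using assms(2,3)
proof (induction "degree p" arbitrary: p v)
  case 0
  then obtain c where "p = [:c:]" "c \<noteq> 0"
    by (metis degree_eq_zeroE pCons_0_0)
  with 0 have "v = 0"
    by (simp add: clinear_0[OF T])
  then show ?case
    by (simp add: complex_vector.span_zero)
next
  case (Suc n)
  then obtain a where "poly p a = 0"
    using fundamental_theorem_of_algebra[of p] by (auto simp: constant_degree)
  then obtain q where p: "p = [:- a, 1:] * q"
    by (auto simp: poly_eq_0_iff_dvd)
  with Suc.prems have "q \<noteq> 0"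
    by auto
  then have "degree p = Suc (degree q)"
    unfolding p by (subst degree_mult_eq) auto
  then have "T v - a *\<^sub>C v \<in> complex_vector.span (eigenvectors T)"
    using Suc.hyps(1)[OF _ \<open>q \<noteq> 0\<close>] Suc.hyps(2) Suc.prems(2)
    by (simp add: p poly_apply_linear_factor del: mult_pCons_left)
  from span_eigenvectors_decomp[OF this, of a] obtain u z
    where u: "u \<in> complex_vector.span (eigenvectors T)"
      and z: "T z = a *\<^sub>C z" "T u = a *\<^sub>C u + (T v - a *\<^sub>C v) - z"
    by auto
  \<comment> \<open>\<open>T - a\<close> sends \<open>v - u\<close> to the kernel vector
    \<open>z\<close>; without Jordan chains \<open>z\<close> vanishes and \<open>v - u\<close> is an
    eigenvector for \<open>a\<close>.\<close>
  have diff: "T (v - u) = a *\<^sub>C (v - u) + z"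
    by (simp add: clinear_diff[OF T] z algebra_simps)
  have "z = 0"
    by (rule symmetric_kernel_square[OF sym z(1) diff])
  with diff have "v - u \<in> eigenvectors T"
    by (auto simp: eigenvectors_def)
  then have "(v - u) + u \<in> complex_vector.span (eigenvectors T)"
    using u by (intro complex_vector.span_add) (auto intro: complex_vector.span_base)
  then show ?case
    by simp
qed

lemma span_eigenvectors_symmetric:
  assumes "finite S" "complex_vector.span S = (UNIV :: 'a set)"
    and "\<And>x y. cinner (T x) y = cinner x (T y)"
  shows "complex_vector.span (eigenvectors T) = UNIV"
  using annihilating_poly_exists[OF assms(1,2)] span_eigenvectors_if_annihilated[OF assms(3)]
  by (metis UNIV_eq_I)

end

section \<open>Components of spanning sets and the Riccati equation\<close>

lemma span_fst_image:
  assumes "complex_vector.span S = (UNIV :: ('a::complex_inner \<times> 'b::complex_inner) set)"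
  shows "complex_vector.span (fst ` S) = UNIV"
proof -
  have "clinear (fst :: 'a \<times> 'b \<Rightarrow> 'a)"
    by (rule clinearI) (simp_all add: scaleC_prod_def)
  from complex_pair.linear_span_image[OF this, of S] show ?thesis
    by (simp add: assms)
qed

lemma span_snd_image:
  assumes "complex_vector.span S = (UNIV :: ('a::complex_inner \<times> 'b::complex_inner) set)"
  shows "complex_vector.span (snd ` S) = UNIV"
proof -
  have "clinear (snd :: 'a \<times> 'b \<Rightarrow> 'b)"
    by (rule clinearI) (simp_all add: scaleC_prod_def)
  from complex_pair.linear_span_image[OF this, of S] show ?thesis
    by (simp add: assms)
qed

theorem corollary1p2:
  fixes A0 :: "'a::chilbert_space \<Rightarrow> 'a"
    and A1 :: "'b::chilbert_space \<Rightarrow> 'b"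
    and V :: "'b \<Rightarrow> 'a"
    and B :: "'a \<times> 'b \<Rightarrow> 'a \<times> 'b"
  assumes "\<exists>S :: ('a \<times> 'b) set. finite S \<and> complex_vector.span S = UNIV"
    and "self_adjoint A0"
    and "self_adjoint A1"
    and "bounded_clinear V"
    and "B = block_operator A0 V (cadjoint V) A1"
    and "spectrum B \<inter> spectrum A0 = {}"
  shows "\<exists>X :: 'a \<Rightarrow> 'b. bounded_clinear X \<and>
    (\<forall>x. A1 (X x) - X (A0 x) - X (V (X x)) + cadjoint V x = 0)"
proof -
  obtain S :: "('a \<times> 'b) set" where S: "finite S" "complex_vector.span S = UNIV"
    using assms(1) by blast
  \<comment> \<open>Finite dimensionality passes from the sum to both summands, which makes the
    adjoints available.\<close>
  have S0: "finite (fst ` S)" "complex_vector.span (fst ` S) = UNIV"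
    and S1: "finite (snd ` S)" "complex_vector.span (snd ` S) = UNIV"
    using S(1) span_fst_image[OF S(2)] span_snd_image[OF S(2)] by simp_all
  have A0: "clinear A0" and A1: "clinear A1" and V: "clinear V"
    using assms(2-4) by (auto simp: self_adjoint_def bounded_clinear_imp_clinear)
  have sym0: "cinner (A0 x) y = cinner x (A0 y)" for x y
    using finite_dim_clinear(2)[OF S0 A0] assms(2) by (simp add: self_adjoint_def)
  have sym1: "cinner (A1 x) y = cinner x (A1 y)" for x y
    using finite_dim_clinear(2)[OF S1 A1] assms(3) by (simp add: self_adjoint_def)
  have adj: "cinner (V x) y = cinner x (cadjoint V y)" for x y
    by (rule finite_dim_clinear(2)[OF S1 V])
  have adj': "cinner (cadjoint V x) y = cinner x (V y)" for x y
    using adj[of y x] cinner_commute by metis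
  have V': "clinear (cadjoint V)"
    by (rule clinear_if_adjoint[OF adj])
  have B_apply: "B (x, y) = (A0 x + V y, cadjoint V x + A1 y)" for x y
    by (simp add: assms(5) block_operator_def)
  have sym: "cinner (B x) y = cinner x (B y)" for x y
    by (cases x; cases y)
      (simp add: B_apply cinner_prod_def cinner_add_left cinner_add_right sym0 sym1 adj adj')
  \<comment> \<open>Symmetry also yields linearity of \<open>B\<close>, as \<open>B\<close> is its
    own adjoint.\<close>
  have "complex_vector.span (eigenvectors B) = UNIV"
    by (rule span_eigenvectors_symmetric[OF clinear_if_adjoint[OF sym] S sym])
  then have "complex_vector.span (fst ` eigenvectors B) = UNIV"
    by (rule span_fst_image)
  moreover obtain E where E: "E \<subseteq> fst ` eigenvectors B" "\<not> complex_vector.dependent E"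
    "fst ` eigenvectors B \<subseteq> complex_vector.span E"
    using complex_vector.maximal_independent_subset by blast
  ultimately have span_E: "complex_vector.span E = UNIV"
    by (metis complex_vector.span_minimal complex_vector.subspace_span top.extremum_uniqueI)
  have "\<forall>x\<in>E. \<exists>y. (x, y) \<in> eigenvectors B"
    using E(1) by force
  then obtain f where f: "\<And>x. x \<in> E \<Longrightarrow> (x, f x) \<in> eigenvectors B"
    by metis
  obtain X where X: "clinear X" and X_f: "\<And>x. x \<in> E \<Longrightarrow> X x = f x"
    using complex_pair.linear_independent_extend[OF E(2), of f] by blast
  \<comment> \<open>The Riccati residual is linear in \<open>x\<close>, although the equation is
    quadratic in \<open>X\<close>, so it suffices that it vanishes on the basis
    \<open>E\<close>.\<close>
  define R where "R x = A1 (X x) - X (A0 x) - X (V (X x)) + cadjoint V x" for x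
  have "clinear R"
    by (rule clinearI)
      (simp_all add: R_def clinear_add[OF A0] clinear_add[OF A1] clinear_add[OF V]
        clinear_add[OF V'] clinear_add[OF X] clinear_scale[OF A0] clinear_scale[OF A1]
        clinear_scale[OF V] clinear_scale[OF V'] clinear_scale[OF X] algebra_simps)
  moreover have "R x = 0" if x: "x \<in> E" for x
  proof -
    obtain a where "B (x, f x) = a *\<^sub>C (x, f x)"
      using f[OF x] by (auto simp: eigenvectors_def)
    then have fst: "A0 x + V (f x) = a *\<^sub>C x" and snd: "cadjoint V x + A1 (f x) = a *\<^sub>C f x"
      by (simp_all add: B_apply scaleC_prod_def)
    \<comment> \<open>Regrouped, the residual compares the second component of
      \<open>B (x, f x)\<close> with \<open>X\<close> of the first; by the eigenvalue equation both
      equal \<open>a *\<^sub>C f x\<close>.\<close>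
    have "R x = (cadjoint V x + A1 (f x)) - X (A0 x + V (f x))"
      by (simp add: R_def X_f[OF x] clinear_add[OF X])
    also have "\<dots> = 0"
      by (simp add: fst snd clinear_scale[OF X] X_f[OF x])
    finally show ?thesis .
  qed
  ultimately have "R x = 0" for x
    using complex_pair.linear_eq_0_on_span[of R E x] span_E by simp
  then show ?thesis
    using finite_dim_clinear(1)[OF S0 X] unfolding R_def by blast
qed

end
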